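(* Let $P$ be a finite set (of "properties"), and let $l$ be a lace-map on $P$, i.e. a map assigning to each subset $S \subseteq P$ a subset $l(S) \subseteq P$ such that for all $S, G, S_1, S_2 \subseteq P$: (i) $l(S) \subseteq S$; (ii) if $l(S) \subseteq G \subseteq S$ then $l(G) = l(S)$; (iii) if $l(S_1) = l(S_2)$ then $l(S_1 \cup S_2) = l(S_1)$. A set $L \subseteq P$ with $l(L) = L$ is called a lace, and $\mathcal{L}$ denotes the collection of all laces. For a lace $L$, let $C(L) = \{ p \in P \setminus L : l(L \cup \{p\}) = L \}$ (the set of properties compatible with $L$). Let $X$ be a finite set, where each element $x \in X$ possesses some subset of the properties in $P$, and let $wt : X \to \mathbb{R}$ be any function. For a lace $L$, let $N(L)$ be the sum of $wt(x)$ over those $x \in X$ that have every property in $L$ and have none of the properties in $C(L)$. Let $N_0(X)$ be the sum of $wt(x)$ over those $x \in X$ that have none of the properties in $P$. Then $$N_0(X) = \sum_{L \in \mathcal{L}} (-1)^{|L|} N(L).$$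
   Context: For a lace $L$, the set $C(L)$ satisfies $\{S \subseteq P : l(S) = L\} = \{S : L \subseteq S \subseteq L \cup C(L)\}$; the formula given for $C(L)$ is the paper's explicit description of this set. *)

theory Defs
  imports Complex_Main
begin

(* Only the values of l on subsets of P matter. *)
definition lace_map :: "'p set \<Rightarrow> ('p set \<Rightarrow> 'p set) \<Rightarrow> bool" where
  "lace_map P l \<longleftrightarrow>
     (\<forall>S. S \<subseteq> P \<longrightarrow> l S \<subseteq> S) \<and>
     (\<forall>S G. S \<subseteq> P \<longrightarrow> G \<subseteq> P \<longrightarrow> l S \<subseteq> G \<longrightarrow> G \<subseteq> S \<longrightarrow> l G = l S) \<and>
     (\<forall>S1 S2. S1 \<subseteq> P \<longrightarrow> S2 \<subseteq> P \<longrightarrow> l S1 = l S2 \<longrightarrow> l (S1 \<union> S2) = l S1)"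

definition laces :: "'p set \<Rightarrow> ('p set \<Rightarrow> 'p set) \<Rightarrow> 'p set set" where
  "laces P l = {L. L \<subseteq> P \<and> l L = L}"

definition compatible :: "'p set \<Rightarrow> ('p set \<Rightarrow> 'p set) \<Rightarrow> 'p set \<Rightarrow> 'p set" where
  "compatible P l L = {p \<in> P - L. l (L \<union> {p}) = L}"

(* In the two definitions below, props x is the set of properties possessed by x. *)
definition N_lace ::
  "'p set \<Rightarrow> ('p set \<Rightarrow> 'p set) \<Rightarrow> 'x set \<Rightarrow> ('x \<Rightarrow> 'p set) \<Rightarrow> ('x \<Rightarrow> real) \<Rightarrow> 'p set \<Rightarrow> real" where
  "N_lace P l X props wt L =
     (\<Sum>x \<in> {x \<in> X. (\<forall>p\<in>L. p \<in> props x) \<and> (\<forall>p\<in>compatible P l L. p \<notin> props x)}. wt x)"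

definition N_zero :: "'p set \<Rightarrow> 'x set \<Rightarrow> ('x \<Rightarrow> 'p set) \<Rightarrow> ('x \<Rightarrow> real) \<Rightarrow> real" where
  "N_zero P X props wt = (\<Sum>x \<in> {x \<in> X. \<forall>p\<in>P. p \<notin> props x}. wt x)"

end

(* For x in X with property set A, the alternating sum of (-1)^|S| over S \<subseteq> A is 1 if A is empty
   and 0 otherwise.  Grouping the S by the lace L = l S, the fibre over L is the Boolean interval
   between L and L \<union> (C(L) \<inter> A), so it contributes (-1)^|L| if L \<subseteq> A and C(L) \<inter> A is empty,
   and 0 otherwise.  Summing against wt gives the formula. *)
theory Submission
  imports Defs
begin

text \<open>For a fixed element \<open>a\<close>, the subsets without \<open>a\<close> pair off with
  those containing it via \<open>insert a\<close>. The two members of a pair have opposite signs, so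
  everything cancels as soon as the set is nonempty.\<close>

lemma sum_Pow_minus_one_power_card:
  assumes "finite A"
  shows "(\<Sum>S\<in>Pow A. (-1) ^ card S) = (if A = {} then 1 else 0 :: 'a :: comm_ring_1)"
  using assms
proof (induction A rule: finite_induct)
  case (insert a A)
  have inj: "inj_on (insert a) (Pow A)"
    using insert.hyps by (intro inj_onI) (metis PowD insert_ident subsetD)
  have "(\<Sum>S\<in>Pow (insert a A). (-1) ^ card S) =
      (\<Sum>S\<in>Pow A. (-1) ^ card S) + (\<Sum>S\<in>insert a ` Pow A. (-1) ^ card S :: 'a)"
    unfolding Pow_insert using insert.hyps by (intro sum.union_disjoint) auto
  also have "(\<Sum>S\<in>insert a ` Pow A. (-1) ^ card S :: 'a) = (\<Sum>S\<in>Pow A. (-1) ^ card (insert a S))"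
    using inj by (simp add: sum.reindex)
  also have "\<dots> = (\<Sum>S\<in>Pow A. - ((-1) ^ card S))"
  proof (rule sum.cong)
    fix S assume "S \<in> Pow A"
    then have "finite S" "a \<notin> S"
      using insert.hyps finite_subset[of S A] by auto
    then show "(-1) ^ card (insert a S) = (- ((-1) ^ card S) :: 'a)"
      by simp
  qed simp
  finally show ?case
    by (simp add: sum_negf)
qed simp

text \<open>Removing \<open>L\<close> maps the interval bijectively onto \<open>Pow C\<close>. Each
  sign splits as (-1)^|L| times the sign of \<open>S - L\<close>, leaving the alternating sum over
  \<open>Pow C\<close>.\<close>

lemma sum_interval_minus_one_power_card:
  assumes "finite L" "finite C" "L \<inter> C = {}"
  shows "(\<Sum>S | L \<subseteq> S \<and> S \<subseteq> L \<union> C. (-1) ^ card S) =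
    (if C = {} then (-1) ^ card L else 0 :: 'a :: comm_ring_1)"
proof -
  have "(\<Sum>S | L \<subseteq> S \<and> S \<subseteq> L \<union> C. (-1) ^ card S) = (\<Sum>T\<in>Pow C. (-1) ^ card L * (-1) ^ card T :: 'a)"
  proof (rule sum.reindex_bij_witness[where i = "\<lambda>T. L \<union> T" and j = "\<lambda>S. S - L"])
    fix S assume "S \<in> {S. L \<subseteq> S \<and> S \<subseteq> L \<union> C}"
    then have S: "L \<subseteq> S" "S \<subseteq> L \<union> C"
      by auto
    then have "finite S"
      using assms(1,2) finite_subset[of S "L \<union> C"] by simp
    then have "card S = card L + card (S - L)"
      using S assms(1) by (simp add: card_Diff_subset card_mono)
    then show "(-1) ^ card L * (-1) ^ card (S - L) = ((-1) ^ card S :: 'a)"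
      by (simp add: power_add)
  qed (use assms in auto)
  also have "\<dots> = (-1) ^ card L * (\<Sum>T\<in>Pow C. (-1) ^ card T)"
    by (simp add: sum_distrib_left)
  finally show ?thesis
    using assms(2) by (simp add: sum_Pow_minus_one_power_card)
qed

lemma lace_map_subset:
  assumes "lace_map P l" "S \<subseteq> P"
  shows "l S \<subseteq> S"
  using assms(1)[unfolded lace_map_def, THEN conjunct1] assms(2) by iprover

lemma lace_map_between:
  assumes "lace_map P l" "S \<subseteq> P" "l S \<subseteq> G" "G \<subseteq> S"
  shows "l G = l S"
  using assms(1)[unfolded lace_map_def, THEN conjunct2, THEN conjunct1]
    assms(2-4) order_trans[OF assms(4,2)] by iprover

lemma lace_map_Un:
  assumes "lace_map P l" "S \<subseteq> P" "T \<subseteq> P" "l S = l T"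
  shows "l (S \<union> T) = l S"
  using assms(1)[unfolded lace_map_def, THEN conjunct2, THEN conjunct2] assms(2-4) by iprover

text \<open>Idempotence of \<open>l\<close> is the betweenness axiom applied to
  \<open>G = l S\<close>, the lower end of the interval.\<close>

lemma lace_map_in_laces:
  assumes "lace_map P l" "S \<subseteq> P"
  shows "l S \<in> laces P l"
proof -
  have "l S \<subseteq> S"
    using assms by (rule lace_map_subset)
  moreover from this have "l (l S) = l S"
    by (rule lace_map_between[OF assms order_refl])
  ultimately show ?thesis
    using assms(2) unfolding laces_def by blast
qed

text \<open>The betweenness axiom shows that every extra element of \<open>S\<close> is compatible
  with \<open>l S\<close>. Conversely, the union axiom allows compatible elements to be added to
  \<open>L\<close> one at a time without changing the lace.\<close>

lemma lace_fibre:
  assumes "finite P" and l: "lace_map P l" and L: "L \<in> laces P l"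
  shows "{S. S \<subseteq> P \<and> l S = L} = {S. L \<subseteq> S \<and> S \<subseteq> L \<union> compatible P l L}"
proof (intro set_eqI iffI; clarify)
  fix S assume S: "S \<subseteq> P" "L = l S"
  then have "l S \<subseteq> S"
    using l by (simp add: lace_map_subset)
  \<comment> \<open>The set \<open>l S \<union> {p}\<close> lies between \<open>l S\<close> and
    \<open>S\<close>, hence has the same lace as \<open>S\<close>.\<close>
  moreover have "p \<in> compatible P l (l S)" if "p \<in> S" "p \<notin> l S" for p
    using that S lace_map_between[OF l S(1), of "l S \<union> {p}"] \<open>l S \<subseteq> S\<close>
    by (auto simp: compatible_def)
  ultimately show "l S \<subseteq> S \<and> S \<subseteq> l S \<union> compatible P l (l S)"
    by blast
next
  fix S assume S: "L \<subseteq> S" "S \<subseteq> L \<union> compatible P l L"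
  have LP: "L \<subseteq> P" "l L = L"
    using L by (auto simp: laces_def)
  then have SP: "S \<subseteq> P"
    using S by (auto simp: compatible_def)
  have "l (L \<union> T) = L" if "finite T" "T \<subseteq> compatible P l L" for T
    using that
  proof (induction T rule: finite_induct)
    case (insert p T)
    \<comment> \<open>Both parts have lace \<open>L\<close>: the first by the induction hypothesis,
      the second by compatibility of \<open>p\<close>.\<close>
    then have "l ((L \<union> T) \<union> (L \<union> {p})) = L"
      using LP by (subst lace_map_Un[OF l]) (auto simp: compatible_def)
    moreover have "(L \<union> T) \<union> (L \<union> {p}) = L \<union> insert p T"
      by blast
    ultimately show ?case
      by simp
  qed (simp add: LP)
  moreover have "finite (S - L)" "S - L \<subseteq> compatible P l L" "L \<union> (S - L) = S"
    using S finite_subset[OF SP assms(1)] by auto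
  ultimately have "l S = L"
    by metis
  with SP show "S \<subseteq> P \<and> l S = L"
    by simp
qed

lemma sum_laces_minus_one_power_card:
  assumes "finite P" and l: "lace_map P l" and "A \<subseteq> P"
  shows "(\<Sum>L | L \<in> laces P l \<and> L \<subseteq> A \<and> compatible P l L \<inter> A = {}. (-1) ^ card L) =
    (if A = {} then 1 else 0 :: 'a :: comm_ring_1)"
proof -
  have fin: "finite (laces P l)" "finite A"
    using assms(1) finite_subset[OF assms(3,1)] by (simp_all add: laces_def)
  have fibre: "(\<Sum>S | S \<in> Pow A \<and> l S = L. (-1) ^ card S) =
      (if L \<subseteq> A \<and> compatible P l L \<inter> A = {} then (-1) ^ card L else 0 :: 'a)"
    if L: "L \<in> laces P l" for L
  proof (cases "L \<subseteq> A")
    case True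
    \<comment> \<open>Restricting the fibre to subsets of \<open>A\<close> keeps it an interval from
      \<open>L\<close>, with only the compatible elements lying in \<open>A\<close> still
      free.\<close>
    have "{S \<in> Pow A. l S = L} = {S. S \<subseteq> P \<and> l S = L} \<inter> Pow A"
      using assms(3) by blast
    also have "\<dots> = {S. L \<subseteq> S \<and> S \<subseteq> L \<union> (compatible P l L \<inter> A)}"
      unfolding lace_fibre[OF assms(1) l L] using True by blast
    finally have *: "{S \<in> Pow A. l S = L} = \<dots>" .
    have "finite L" "finite (compatible P l L \<inter> A)" "L \<inter> (compatible P l L \<inter> A) = {}"
      using finite_subset[OF True fin(2)] fin(2) by (auto simp: compatible_def)
    then show ?thesis
      unfolding * using True by (simp add: sum_interval_minus_one_power_card)
  next
    case False
    \<comment> \<open>Any \<open>S\<close> in this fibre would give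
      \<open>L = l S \<subseteq> S \<subseteq> A\<close>.\<close>
    then have "{S \<in> Pow A. l S = L} = {}"
      using lace_map_subset[OF l] assms(3) by blast
    then show ?thesis
      using False by (simp only: sum.empty if_False simp_thms)
  qed
  have "(\<Sum>S\<in>Pow A. (-1) ^ card S :: 'a) =
      (\<Sum>L\<in>laces P l. \<Sum>S | S \<in> Pow A \<and> l S = L. (-1) ^ card S)"
    using fin lace_map_in_laces[OF l] assms(3) by (intro sum.group[symmetric]) auto
  also have "\<dots> = (\<Sum>L\<in>laces P l. if L \<subseteq> A \<and> compatible P l L \<inter> A = {} then (-1) ^ card L else 0)"
    by (intro sum.cong refl fibre)
  also have "\<dots> = (\<Sum>L | L \<in> laces P l \<and> L \<subseteq> A \<and> compatible P l L \<inter> A = {}. (-1) ^ card L)"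
    by (rule sum.inter_filter[OF fin(1), symmetric])
  finally show ?thesis
    using fin(2) by (simp add: sum_Pow_minus_one_power_card)
qed

theorem mainTheorem1:
  fixes P :: "'p set"
    and l :: "'p set \<Rightarrow> 'p set"
    and X :: "'x set"
    and props :: "'x \<Rightarrow> 'p set"
    and wt :: "'x \<Rightarrow> real"
  assumes "finite P"
    and "lace_map P l"
    and "finite X"
    and "\<And>x. x \<in> X \<Longrightarrow> props x \<subseteq> P"
  shows "N_zero P X props wt = (\<Sum>L \<in> laces P l. (-1) ^ card L * N_lace P l X props wt L)"
proof -
  let ?good = "\<lambda>L x. L \<subseteq> props x \<and> compatible P l L \<inter> props x = {}"
  have fin: "finite (laces P l)"
    using assms(1) by (simp add: laces_def)
  \<comment> \<open>Moving the condition on \<open>x\<close> into the summand makes the index set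
    \<open>X\<close> independent of \<open>L\<close>, so that the two sums can be swapped.\<close>
  have N_lace: "N_lace P l X props wt L = (\<Sum>x\<in>X. if ?good L x then wt x else 0)" for L
    unfolding N_lace_def sum.inter_filter[OF assms(3)] by (intro sum.cong if_cong) auto
  have "(\<Sum>L\<in>laces P l. (-1) ^ card L * N_lace P l X props wt L) =
      (\<Sum>L\<in>laces P l. \<Sum>x\<in>X. if ?good L x then (-1) ^ card L * wt x else 0)"
    unfolding N_lace sum_distrib_left by (intro sum.cong refl) simp
  also have "\<dots> = (\<Sum>x\<in>X. \<Sum>L\<in>laces P l. if ?good L x then (-1) ^ card L * wt x else 0)"
    by (rule sum.swap)
  also have "\<dots> = (\<Sum>x\<in>X. (\<Sum>L | L \<in> laces P l \<and> ?good L x. (-1) ^ card L) * wt x)"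
    unfolding sum_distrib_right sum.inter_filter[OF fin] by (intro sum.cong refl) simp
  also have "\<dots> = (\<Sum>x\<in>X. if props x = {} then wt x else 0)"
    using sum_laces_minus_one_power_card[OF assms(1,2) assms(4), where 'a = real]
    by (intro sum.cong) auto
  also have "\<dots> = N_zero P X props wt"
    \<comment> \<open>Since \<open>props x \<subseteq> P\<close>, having no property in
      \<open>P\<close> amounts to \<open>props x = {}\<close>.\<close>
    unfolding N_zero_def sum.inter_filter[OF assms(3)]
    using assms(4) by (intro sum.cong if_cong) auto
  finally show ?thesis ..
qed

end
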